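(* Let $\mathcal{X}$ be a compact metric space, $\alpha\in(0,1]$, $x^{(1)},\ldots,x^{(M)}\in\mathcal{X}$, $\varepsilon_1,\ldots,\varepsilon_M\ge 0$, and let $\mathbf{y}\in\mathbb{R}^M$ be a data vector of the form $y_m=f_0(x^{(m)})+e_m$, $|e_m|\le\varepsilon_m$, $m=1,\ldots,M$, for some $f_0\in\mathcal{H}_\alpha$. Let $Z$ be a Banach lattice and let $\Gamma:B(\mathcal{X})\to Z$ be a (not necessarily linear) monotone map, i.e., $f\ge f'$ implies $\Gamma(f)\ge\Gamma(f')$ for all $f,f'\in B(\mathcal{X})$. For $z\in Z$, put $$\mathrm{lwce}_{\mathbf{y},\boldsymbol{\varepsilon}}(z):=\sup\big\{\|\Gamma(f)-z\|_Z:\ f\in\mathcal{H}_\alpha,\ |y_m-f(x^{(m)})|\le\varepsilon_m\ \text{for all } m=1,\ldots,M\big\}.$$ Then a minimizer of $\mathrm{lwce}_{\mathbf{y},\boldsymbol{\varepsilon}}(z)$ over all $z\in Z$ is given by $$\widehat{z}_{\mathbf{y},\boldsymbol{\varepsilon}}=\frac{\Gamma(\ell_{\mathbf{y},\boldsymbol{\varepsilon}})+\Gamma(u_{\mathbf{y},\boldsymbol{\varepsilon}})}{2},$$ and the value of the minimum is $$\widehat{r}_{\mathbf{y},\boldsymbol{\varepsilon}}=\frac{\|\Gamma(u_{\mathbf{y},\boldsymbol{\varepsilon}})-\Gamma(\ell_{\mathbf{y},\boldsymbol{\varepsilon}})\|_Z}{2}.$$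
   Context: $\mathcal{H}_\alpha:=\{f:\mathcal{X}\to\mathbb{R} : |f(x)-f(x')|\le\mathrm{dist}(x,x')^\alpha \text{ for all } x,x'\in\mathcal{X}\}$. $B(\mathcal{X})$ is the space of bounded real-valued functions on $\mathcal{X}$ with the pointwise order. $M\ge1$ and $\mathcal{X}$ is nonempty. A Banach lattice has the usual order and absolute value $|z|=\max\{z,-z\}$, and its norm satisfies: $|z|\ge|z'|$ implies $\|z\|_Z\ge\|z'\|_Z$. The lower and upper functions are $$\ell_{\mathbf{y},\boldsymbol{\varepsilon}}(x):=\max_{1\le m\le M}\big(y_m-\varepsilon_m-\mathrm{dist}(x,x^{(m)})^\alpha\big),\qquad u_{\mathbf{y},\boldsymbol{\varepsilon}}(x):=\min_{1\le m\le M}\big(y_m+\varepsilon_m+\mathrm{dist}(x,x^{(m)})^\alpha\big),\qquad x\in\mathcal{X}.$$ *)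

theory Defs
  imports "HOL-Analysis.Analysis" "HOL-Library.Lattice_Algebras"
begin

(* lattice_ab_group_add_abs contributes the lattice order, its compatibility with addition and
   the law abs a = sup a (- a); ordered_real_vector the compatibility with scalar multiplication. *)
class banach_lattice = banach + ordered_real_vector + lattice_ab_group_add_abs +
  assumes norm_mono_abs: "\<bar>a\<bar> \<le> \<bar>b\<bar> \<Longrightarrow> norm a \<le> norm b"

instance real :: banach_lattice
  by standard (auto simp: sup_real_def max_def)

definition bounded_funs :: "('a \<Rightarrow> real) set" where
  "bounded_funs = {f. bounded (range f)}"

(* Since 0 powr \<alpha> = 0, the function dist x x' powr \<alpha> vanishes at x = x', as it should for \<alpha> > 0. *)
definition holder_class :: "real \<Rightarrow> ('a::metric_space \<Rightarrow> real) set" where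
  "holder_class \<alpha> = {f. \<forall>x x'. \<bar>f x - f x'\<bar> \<le> dist x x' powr \<alpha>}"

(* Throughout, M is the number of data, p 1, ..., p M are the data sites, y 1, ..., y M the data
   values and \<epsilon> 1, ..., \<epsilon> M the error bounds; values at other indices are irrelevant. *)

definition lower_fun ::
  "real \<Rightarrow> nat \<Rightarrow> (nat \<Rightarrow> 'a::metric_space) \<Rightarrow> (nat \<Rightarrow> real) \<Rightarrow> (nat \<Rightarrow> real) \<Rightarrow> 'a \<Rightarrow> real" where
  "lower_fun \<alpha> M p y \<epsilon> = (\<lambda>x. MAX m\<in>{1..M}. y m - \<epsilon> m - dist x (p m) powr \<alpha>)"

definition upper_fun ::
  "real \<Rightarrow> nat \<Rightarrow> (nat \<Rightarrow> 'a::metric_space) \<Rightarrow> (nat \<Rightarrow> real) \<Rightarrow> (nat \<Rightarrow> real) \<Rightarrow> 'a \<Rightarrow> real" where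
  "upper_fun \<alpha> M p y \<epsilon> = (\<lambda>x. MIN m\<in>{1..M}. y m + \<epsilon> m + dist x (p m) powr \<alpha>)"

definition consistent_funs ::
  "real \<Rightarrow> nat \<Rightarrow> (nat \<Rightarrow> 'a::metric_space) \<Rightarrow> (nat \<Rightarrow> real) \<Rightarrow> (nat \<Rightarrow> real) \<Rightarrow> ('a \<Rightarrow> real) set" where
  "consistent_funs \<alpha> M p y \<epsilon> = {f \<in> holder_class \<alpha>. \<forall>m\<in>{1..M}. \<bar>y m - f (p m)\<bar> \<le> \<epsilon> m}"

(* Local worst-case error; the supremum is taken in the extended reals, so that it is meaningful
   without first knowing that the set of errors is bounded. *)
definition lwce ::
  "real \<Rightarrow> nat \<Rightarrow> (nat \<Rightarrow> 'a::metric_space) \<Rightarrow> (nat \<Rightarrow> real) \<Rightarrow> (nat \<Rightarrow> real) \<Rightarrow>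
    (('a \<Rightarrow> real) \<Rightarrow> 'z::real_normed_vector) \<Rightarrow> 'z \<Rightarrow> ereal" where
  "lwce \<alpha> M p y \<epsilon> \<Gamma> z = (SUP f\<in>consistent_funs \<alpha> M p y \<epsilon>. ereal (norm (\<Gamma> f - z)))"

end

theory Submission
  imports Defs
begin

text \<open>
  The lower and upper functions are themselves consistent with the data, since
  \<open>dist\<close> raised to a power \<open>\<alpha> \<le> 1\<close> is again a metric, and they enclose every consistent function.
  By monotonicity all values \<open>\<Gamma> f\<close> lie in the order interval from \<open>\<Gamma> l\<close> to \<open>\<Gamma> u\<close>, whose midpoint is
  within half of its length of every element, in the sense of the absolute value and hence of the
  norm. Conversely, by the triangle inequality no \<open>z\<close> is closer than that to both end points,
  which are attained.
\<close>

text \<open>Dividing by \<open>s = b + c\<close> reduces the claim to numbers in the unit interval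
  with sum 1; raising those to a power \<alpha> \<le> 1 can only enlarge them. Monotonicity of the
  power then passes from \<open>s\<close> to \<open>a\<close>.\<close>

lemma powr_subadditive:
  fixes a b c \<alpha> :: real
  assumes "0 \<le> a" "0 \<le> b" "0 \<le> c" "a \<le> b + c" "0 < \<alpha>" "\<alpha> \<le> 1"
  shows "a powr \<alpha> \<le> b powr \<alpha> + c powr \<alpha>"
proof (cases "b + c = 0")
  case True
  with assms show ?thesis by simp
next
  case False
  define s where "s = b + c"
  have s: "s > 0" using False assms by (simp add: s_def)
  have le: "t \<le> t powr \<alpha>" if "0 \<le> t" "t \<le> 1" for t :: real
    using powr_mono'[of \<alpha> 1 t] that assms by simp
  have "1 = b / s + c / s"
    using s by (simp add: s_def add_divide_distrib[symmetric])
  also have "\<dots> \<le> (b / s) powr \<alpha> + (c / s) powr \<alpha>"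
    using s assms by (intro add_mono le) (auto simp: s_def)
  also have "\<dots> = (b powr \<alpha> + c powr \<alpha>) / s powr \<alpha>"
    using s assms by (simp add: powr_divide add_divide_distrib)
  finally have "s powr \<alpha> \<le> b powr \<alpha> + c powr \<alpha>"
    using s by (simp add: field_simps)
  moreover have "a powr \<alpha> \<le> s powr \<alpha>"
    using assms by (intro powr_mono2) (auto simp: s_def)
  ultimately show ?thesis by simp
qed

lemma dist_powr_triangle:
  fixes x y z :: "'a::metric_space"
  assumes "0 < \<alpha>" "\<alpha> \<le> 1"
  shows "dist x z powr \<alpha> \<le> dist x y powr \<alpha> + dist y z powr \<alpha>"
  using assms by (intro powr_subadditive dist_triangle) auto

text \<open>A one-sided bound suffices: exchanging the two points gives the other side, as
  \<open>dist\<close> is symmetric.\<close>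

lemma holder_classI:
  assumes "\<And>x x'. f x \<le> f x' + dist x x' powr \<alpha>"
  shows "f \<in> holder_class \<alpha>"
  unfolding holder_class_def
proof (intro CollectI allI)
  fix x x'
  show "\<bar>f x - f x'\<bar> \<le> dist x x' powr \<alpha>"
    using assms[of x x'] assms[of x' x] by (simp add: dist_commute abs_le_iff)
qed

text \<open>Values differ from the one at a fixed point by at most a power of the radius. This is
  what gives access to the monotonicity of \<Gamma>, which is assumed on bounded functions
  only.\<close>

lemma holder_class_bounded:
  fixes f :: "'a::metric_space \<Rightarrow> real"
  assumes "bounded (UNIV :: 'a set)" "0 < \<alpha>" "f \<in> holder_class \<alpha>"
  shows "f \<in> bounded_funs"
proof -
  obtain x0 :: 'a and B where B: "\<And>x. dist x0 x \<le> B"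
    using assms(1) unfolding bounded_def by auto
  have "dist (f x0) (f x) \<le> B powr \<alpha>" for x
  proof -
    have "dist (f x0) (f x) \<le> dist x0 x powr \<alpha>"
      using assms(3) by (simp add: holder_class_def dist_real_def)
    also have "\<dots> \<le> B powr \<alpha>"
      using assms(2) B by (intro powr_mono2) auto
    finally show ?thesis .
  qed
  then show ?thesis
    unfolding bounded_funs_def bounded_def by auto
qed

lemma lower_fun_ge:
  "m \<in> {1..M} \<Longrightarrow> y m - \<epsilon> m - dist x (p m) powr \<alpha> \<le> lower_fun \<alpha> M p y \<epsilon> x"
  unfolding lower_fun_def by (intro Max_ge finite_imageI imageI) auto

text \<open>Each term of the maximum satisfies the bound by the triangle inequality for the power of
  \<open>dist\<close>, and a maximum inherits it.\<close>

lemma lower_fun_holder: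
  assumes "0 < \<alpha>" "\<alpha> \<le> 1" "1 \<le> M"
  shows "lower_fun \<alpha> M p y \<epsilon> \<in> holder_class \<alpha>"
proof (rule holder_classI)
  fix x x'
  have "y m - \<epsilon> m - dist x (p m) powr \<alpha> \<le> lower_fun \<alpha> M p y \<epsilon> x' + dist x x' powr \<alpha>"
    if "m \<in> {1..M}" for m
  proof -
    have "y m - \<epsilon> m - dist x' (p m) powr \<alpha> \<le> lower_fun \<alpha> M p y \<epsilon> x'"
      using that by (rule lower_fun_ge)
    then show ?thesis
      using dist_powr_triangle[OF assms(1,2), of x' "p m" x] by (simp add: dist_commute)
  qed
  then show "lower_fun \<alpha> M p y \<epsilon> x \<le> lower_fun \<alpha> M p y \<epsilon> x' + dist x x' powr \<alpha>"
    using assms(3) by (subst lower_fun_def) (intro Max.boundedI, auto)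
qed

text \<open>Reflection: negating the data exchanges the two envelopes up to sign, so that facts
  about the upper function follow from those about the lower one.\<close>

lemma upper_fun_eq_lower_fun:
  assumes "1 \<le> M"
  shows "upper_fun \<alpha> M p y \<epsilon> x = - lower_fun \<alpha> M p (\<lambda>m. - y m) \<epsilon> x"
proof -
  have "- lower_fun \<alpha> M p (\<lambda>m. - y m) \<epsilon> x
      = (MIN m\<in>{1..M}. - (- y m - \<epsilon> m - dist x (p m) powr \<alpha>))"
    unfolding lower_fun_def using assms by (subst minus_Max_eq_Min) (auto simp: image_image)
  then show ?thesis by (simp add: upper_fun_def algebra_simps)
qed

lemma consistent_funs_uminus:
  "(\<lambda>x. - f x) \<in> consistent_funs \<alpha> M p (\<lambda>m. - y m) \<epsilon> \<longleftrightarrow> f \<in> consistent_funs \<alpha> M p y \<epsilon>"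
proof -
  have "\<bar>- a + b\<bar> = \<bar>a - b\<bar>" for a b :: real by simp
  then show ?thesis by (simp add: consistent_funs_def holder_class_def)
qed

text \<open>From the value of \<open>f\<close> at a data site, which is at least
  \<open>y m - \<epsilon> m\<close>, the function can drop by no more than the power of the distance
  on the way to \<open>x\<close>.\<close>

lemma lower_fun_le:
  assumes "1 \<le> M" "f \<in> consistent_funs \<alpha> M p y \<epsilon>"
  shows "lower_fun \<alpha> M p y \<epsilon> x \<le> f x"
proof -
  have "y m - \<epsilon> m - dist x (p m) powr \<alpha> \<le> f x" if "m \<in> {1..M}" for m
  proof -
    have "\<bar>y m - f (p m)\<bar> \<le> \<epsilon> m" "\<bar>f x - f (p m)\<bar> \<le> dist x (p m) powr \<alpha>"
      using assms(2) that by (auto simp: consistent_funs_def holder_class_def)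
    then show ?thesis by linarith
  qed
  then show ?thesis
    unfolding lower_fun_def using assms(1) by (intro Max.boundedI) auto
qed

lemma le_upper_fun:
  assumes "1 \<le> M" "f \<in> consistent_funs \<alpha> M p y \<epsilon>"
  shows "f x \<le> upper_fun \<alpha> M p y \<epsilon> x"
  using lower_fun_le[OF assms(1), of "\<lambda>x. - f x" \<alpha> p "\<lambda>m. - y m" \<epsilon> x] assms
  by (simp add: consistent_funs_uminus upper_fun_eq_lower_fun)

lemma lower_fun_consistent:
  assumes "0 < \<alpha>" "\<alpha> \<le> 1" "1 \<le> M" "f0 \<in> consistent_funs \<alpha> M p y \<epsilon>"
  shows "lower_fun \<alpha> M p y \<epsilon> \<in> consistent_funs \<alpha> M p y \<epsilon>"
proof -
  have "\<bar>y m - lower_fun \<alpha> M p y \<epsilon> (p m)\<bar> \<le> \<epsilon> m" if m: "m \<in> {1..M}" for m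
  proof -
    \<comment> \<open>The distance term vanishes since \<open>0 powr \<alpha> = 0\<close>, which
      leaves the bound \<open>y m - \<epsilon> m\<close> from below.\<close>
    have "y m - \<epsilon> m - dist (p m) (p m) powr \<alpha> \<le> lower_fun \<alpha> M p y \<epsilon> (p m)"
      using m by (rule lower_fun_ge)
    \<comment> \<open>The bound from above needs a witness that the data are compatible: other sites
      could push the maximum beyond \<open>y m + \<epsilon> m\<close>, but not above
      \<open>f0\<close>.\<close>
    moreover have "lower_fun \<alpha> M p y \<epsilon> (p m) \<le> f0 (p m)"
      using assms by (intro lower_fun_le)
    moreover have "\<bar>y m - f0 (p m)\<bar> \<le> \<epsilon> m"
      using assms(4) m by (auto simp: consistent_funs_def)
    ultimately show ?thesis by simp
  qed
  then show ?thesis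
    using lower_fun_holder assms by (auto simp: consistent_funs_def)
qed

lemma upper_fun_consistent:
  assumes "0 < \<alpha>" "\<alpha> \<le> 1" "1 \<le> M" "f0 \<in> consistent_funs \<alpha> M p y \<epsilon>"
  shows "upper_fun \<alpha> M p y \<epsilon> \<in> consistent_funs \<alpha> M p y \<epsilon>"
proof -
  \<comment> \<open>The witness for the negated data is the negative of \<open>f0\<close>.\<close>
  have "lower_fun \<alpha> M p (\<lambda>m. - y m) \<epsilon> \<in> consistent_funs \<alpha> M p (\<lambda>m. - y m) \<epsilon>"
    using assms by (intro lower_fun_consistent[OF _ _ _ iffD2[OF consistent_funs_uminus]])
      (simp_all add: consistent_funs_uminus)
  then have "(\<lambda>x. - upper_fun \<alpha> M p y \<epsilon> x) \<in> consistent_funs \<alpha> M p (\<lambda>m. - y m) \<epsilon>"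
    using assms(3) by (simp add: upper_fun_eq_lower_fun)
  then show ?thesis by (simp add: consistent_funs_uminus)
qed

lemma norm_diff_midpoint_le:
  fixes a b w :: "'z::banach_lattice"
  assumes "a \<le> w" "w \<le> b"
  shows "norm (w - (1 / 2) *\<^sub>R (a + b)) \<le> norm (b - a) / 2"
proof -
  define h where "h = (1 / 2) *\<^sub>R (b - a)"
  have half: "(1 / 2) *\<^sub>R c + (1 / 2) *\<^sub>R c = c" for c :: 'z
    by (simp add: scaleR_left_distrib[symmetric])
  \<comment> \<open>The form \<open>b - h\<close> turns \<open>w \<le> b\<close> into a bound on the
    deviation of \<open>w\<close>, and the form \<open>a + h\<close> turns \<open>a \<le> w\<close>
    into one on its negative.\<close>
  have mid: "(1 / 2) *\<^sub>R (a + b) = a + h" "(1 / 2) *\<^sub>R (a + b) = b - h"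
    unfolding h_def using half[of a] half[of b]
    by (simp_all add: algebra_simps)
  have "0 \<le> h"
    unfolding h_def using assms by (intro scaleR_nonneg_nonneg) auto
  have "w - (1 / 2) *\<^sub>R (a + b) \<le> h"
    using assms(2) unfolding mid(2) by (simp add: algebra_simps)
  moreover have "- (w - (1 / 2) *\<^sub>R (a + b)) \<le> h"
    using assms(1) unfolding mid(1) by (simp add: algebra_simps)
  \<comment> \<open>The lattice norm compares absolute values, so \<open>h\<close> is replaced by
    its own absolute value, which equals \<open>h\<close> by nonnegativity.\<close>
  ultimately have "\<bar>w - (1 / 2) *\<^sub>R (a + b)\<bar> \<le> \<bar>h\<bar>"
    using \<open>0 \<le> h\<close> by (simp add: abs_leI)
  then have "norm (w - (1 / 2) *\<^sub>R (a + b)) \<le> norm h"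
    by (rule norm_mono_abs)
  then show ?thesis by (simp add: h_def)
qed

text \<open>The distance between two values of \<Gamma> is at most the sum of their distances to
  \<open>z\<close>, so the larger of these is at least half of it.\<close>

lemma half_norm_diff_le_lwce:
  assumes "f \<in> consistent_funs \<alpha> M p y \<epsilon>" "g \<in> consistent_funs \<alpha> M p y \<epsilon>"
  shows "ereal (norm (\<Gamma> g - \<Gamma> f) / 2) \<le> lwce \<alpha> M p y \<epsilon> \<Gamma> z"
proof -
  have "norm (\<Gamma> g - \<Gamma> f) \<le> norm (\<Gamma> g - z) + norm (\<Gamma> f - z)"
    using norm_triangle_ineq4[of "\<Gamma> g - z" "\<Gamma> f - z"] by simp
  then have "norm (\<Gamma> g - \<Gamma> f) / 2 \<le> max (norm (\<Gamma> g - z)) (norm (\<Gamma> f - z))"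
    by linarith
  then have "ereal (norm (\<Gamma> g - \<Gamma> f) / 2) \<le> max (ereal (norm (\<Gamma> g - z))) (ereal (norm (\<Gamma> f - z)))"
    by (simp add: max_def split: if_splits)
  also have "\<dots> \<le> lwce \<alpha> M p y \<epsilon> \<Gamma> z"
    unfolding lwce_def using assms by (auto intro: SUP_upper)
  finally show ?thesis .
qed

theorem theorem1:
  fixes \<alpha> :: real and M :: nat
    and p :: "nat \<Rightarrow> 'a::metric_space"
    and y \<epsilon> e :: "nat \<Rightarrow> real"
    and f0 :: "'a \<Rightarrow> real"
    and \<Gamma> :: "('a \<Rightarrow> real) \<Rightarrow> 'z::banach_lattice"
  assumes "compact (UNIV :: 'a set)"
    and "0 < \<alpha>" and "\<alpha> \<le> 1"
    and "1 \<le> M"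
    and "\<forall>m\<in>{1..M}. 0 \<le> \<epsilon> m"
    and "f0 \<in> holder_class \<alpha>"
    and "\<forall>m\<in>{1..M}. y m = f0 (p m) + e m \<and> \<bar>e m\<bar> \<le> \<epsilon> m"
    and "mono_on bounded_funs \<Gamma>"
  defines "l \<equiv> lower_fun \<alpha> M p y \<epsilon>" and "u \<equiv> upper_fun \<alpha> M p y \<epsilon>"
  defines "z_hat \<equiv> (1 / 2) *\<^sub>R (\<Gamma> l + \<Gamma> u)"
  shows "(\<forall>z. lwce \<alpha> M p y \<epsilon> \<Gamma> z_hat \<le> lwce \<alpha> M p y \<epsilon> \<Gamma> z)
    \<and> lwce \<alpha> M p y \<epsilon> \<Gamma> z_hat = ereal (norm (\<Gamma> u - \<Gamma> l) / 2)"
proof -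
  let ?C = "consistent_funs \<alpha> M p y \<epsilon>"
  \<comment> \<open>The residual of \<open>f0\<close> at the site \<open>p m\<close> is exactly the
    noise \<open>e m\<close>.\<close>
  have f0: "f0 \<in> ?C"
    using assms(6,7) by (simp add: consistent_funs_def)
  have l: "l \<in> ?C" and u: "u \<in> ?C"
    unfolding l_def u_def
    using lower_fun_consistent[OF assms(2,3,4) f0] upper_fun_consistent[OF assms(2,3,4) f0] .
  have bdd: "f \<in> bounded_funs" if "f \<in> ?C" for f
    using holder_class_bounded[OF compact_imp_bounded[OF assms(1)] assms(2)] that
    by (simp add: consistent_funs_def)
  have err: "norm (\<Gamma> f - z_hat) \<le> norm (\<Gamma> u - \<Gamma> l) / 2" if f: "f \<in> ?C" for f
    unfolding z_hat_def
  proof (rule norm_diff_midpoint_le)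
    show "\<Gamma> l \<le> \<Gamma> f"
      using lower_fun_le[OF assms(4) f] bdd[OF l] bdd[OF f]
      by (intro mono_onD[OF assms(8)]) (auto simp: l_def le_fun_def)
    show "\<Gamma> f \<le> \<Gamma> u"
      using le_upper_fun[OF assms(4) f] bdd[OF u] bdd[OF f]
      by (intro mono_onD[OF assms(8)]) (auto simp: u_def le_fun_def)
  qed
  have upper: "lwce \<alpha> M p y \<epsilon> \<Gamma> z_hat \<le> ereal (norm (\<Gamma> u - \<Gamma> l) / 2)"
    unfolding lwce_def using err by (intro SUP_least) simp
  \<comment> \<open>The center \<open>z\<close> stays free: at \<open>z_hat\<close> this bound gives
    the value of the minimum, and at every other \<open>z\<close> it gives minimality.\<close>
  note lower = half_norm_diff_le_lwce[OF l u, of \<Gamma>]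
  show ?thesis
    using upper lower by (blast intro: order.trans order.antisym)
qed

end
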